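(* Let $A,B,C$ be complex vector spaces of dimension $m$. The 111-algebra $\mathcal A_{111}^T$ of a concise tensor $T\in A\otimes B\otimes C$ is a commutative unital subalgebra of $\mathrm{End}(A)\times\mathrm{End}(B)\times\mathrm{End}(C)$, and its projection to any of the three factors is injective.
   Context: A tensor $T\in A\otimes B\otimes C$ is concise if the induced linear maps $A^*\to B\otimes C$, $B^*\to A\otimes C$, $C^*\to A\otimes B$ are injective. For $X\in\mathrm{End}(A)$ put $X\circ_A T:=(X\otimes\mathrm{Id}_B\otimes\mathrm{Id}_C)(T)$, and similarly $Y\circ_B T:=(\mathrm{Id}_A\otimes Y\otimes\mathrm{Id}_C)(T)$ for $Y\in\mathrm{End}(B)$ and $Z\circ_C T:=(\mathrm{Id}_A\otimes\mathrm{Id}_B\otimes Z)(T)$ for $Z\in\mathrm{End}(C)$. A triple $(X,Y,Z)\in\mathrm{End}(A)\times\mathrm{End}(B)\times\mathrm{End}(C)$ is compatible with $T$ if $X\circ_A T=Y\circ_B T=Z\circ_C T$. The 111-algebra $\mathcal A_{111}^T$ is the set of all triples compatible with $T$. *)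

theory Defs
  imports Complex_Main "HOL-Library.Function_Algebras" "HOL-Library.Product_Plus"
begin

text \<open>
  A complex vector space is a type of class \<^class>\<open>ab_group_add\<close> together with a scalar
  multiplication \<open>s\<close> by complex numbers such that \<^term>\<open>vector_space s\<close>.
\<close>

definition has_dimension :: "(complex \<Rightarrow> 'v \<Rightarrow> 'v::ab_group_add) \<Rightarrow> nat \<Rightarrow> bool" where
  "has_dimension s m \<longleftrightarrow> (\<exists>basis. finite_dimensional_vector_space s basis \<and> card basis = m)"

definition dual :: "(complex \<Rightarrow> 'v \<Rightarrow> 'v::ab_group_add) \<Rightarrow> ('v \<Rightarrow> complex) set" where
  "dual s = {\<phi>. Vector_Spaces.linear s (*) \<phi>}"

definition End :: "(complex \<Rightarrow> 'v \<Rightarrow> 'v::ab_group_add) \<Rightarrow> ('v \<Rightarrow> 'v) set" where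
  "End s = {X. Vector_Spaces.linear s s X}"

text \<open>
  The tensor product of \<open>A\<close>, \<open>B\<close>, \<open>C\<close> is realised in the usual way inside the trilinear forms
  on the duals: \<open>a \<otimes> b \<otimes> c\<close> is the form sending \<open>(\<alpha>, \<beta>, \<gamma>)\<close> to \<open>\<alpha> a * \<beta> b * \<gamma> c\<close>, and the
  tensor product is the linear span of these forms. HOL functions being total, a form is extended
  by 0 to arguments which are not all linear functionals, so that equality of tensors is equality
  of HOL functions.
\<close>

type_synonym ('a, 'b, 'c) tensor =
  "('a \<Rightarrow> complex) \<Rightarrow> ('b \<Rightarrow> complex) \<Rightarrow> ('c \<Rightarrow> complex) \<Rightarrow> complex"

definition on_duals ::
    "(complex \<Rightarrow> 'a \<Rightarrow> 'a::ab_group_add) \<Rightarrow> (complex \<Rightarrow> 'b \<Rightarrow> 'b::ab_group_add) \<Rightarrow>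
     (complex \<Rightarrow> 'c \<Rightarrow> 'c::ab_group_add) \<Rightarrow> ('a, 'b, 'c) tensor \<Rightarrow> ('a, 'b, 'c) tensor" where
  "on_duals sA sB sC F =
     (\<lambda>\<alpha> \<beta> \<gamma>. if \<alpha> \<in> dual sA \<and> \<beta> \<in> dual sB \<and> \<gamma> \<in> dual sC then F \<alpha> \<beta> \<gamma> else 0)"

definition simple_tensor ::
    "(complex \<Rightarrow> 'a \<Rightarrow> 'a::ab_group_add) \<Rightarrow> (complex \<Rightarrow> 'b \<Rightarrow> 'b::ab_group_add) \<Rightarrow>
     (complex \<Rightarrow> 'c \<Rightarrow> 'c::ab_group_add) \<Rightarrow> 'a \<Rightarrow> 'b \<Rightarrow> 'c \<Rightarrow> ('a, 'b, 'c) tensor" where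
  "simple_tensor sA sB sC a b c = on_duals sA sB sC (\<lambda>\<alpha> \<beta> \<gamma>. \<alpha> a * \<beta> b * \<gamma> c)"

definition tensor_scale :: "complex \<Rightarrow> ('a, 'b, 'c) tensor \<Rightarrow> ('a, 'b, 'c) tensor" where
  "tensor_scale z T = (\<lambda>\<alpha> \<beta> \<gamma>. z * T \<alpha> \<beta> \<gamma>)"

definition tensor_product ::
    "(complex \<Rightarrow> 'a \<Rightarrow> 'a::ab_group_add) \<Rightarrow> (complex \<Rightarrow> 'b \<Rightarrow> 'b::ab_group_add) \<Rightarrow>
     (complex \<Rightarrow> 'c \<Rightarrow> 'c::ab_group_add) \<Rightarrow> ('a, 'b, 'c) tensor set" where
  "tensor_product sA sB sC =
     module.span tensor_scale {simple_tensor sA sB sC a b c | a b c. True}"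

text \<open>
  The map \<open>X \<otimes> Y \<otimes> Z\<close>; lemma \<open>tensor_map_simple_tensor\<close> below gives its values on the spanning
  set, and lemmas \<open>tensor_map_add\<close>, \<open>tensor_map_scale\<close> its linearity.
\<close>

definition tensor_map ::
    "(complex \<Rightarrow> 'a \<Rightarrow> 'a::ab_group_add) \<Rightarrow> (complex \<Rightarrow> 'b \<Rightarrow> 'b::ab_group_add) \<Rightarrow>
     (complex \<Rightarrow> 'c \<Rightarrow> 'c::ab_group_add) \<Rightarrow> ('a \<Rightarrow> 'a) \<Rightarrow> ('b \<Rightarrow> 'b) \<Rightarrow> ('c \<Rightarrow> 'c) \<Rightarrow>
     ('a, 'b, 'c) tensor \<Rightarrow> ('a, 'b, 'c) tensor" where
  "tensor_map sA sB sC X Y Z T = on_duals sA sB sC (\<lambda>\<alpha> \<beta> \<gamma>. T (\<alpha> \<circ> X) (\<beta> \<circ> Y) (\<gamma> \<circ> Z))"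

lemma module_tensor_scale: "module (tensor_scale :: complex \<Rightarrow> ('a, 'b, 'c) tensor \<Rightarrow> _)"
  by unfold_locales (simp_all add: tensor_scale_def fun_eq_iff algebra_simps)

lemma dual_comp_End: "\<phi> \<in> dual s \<Longrightarrow> X \<in> End s \<Longrightarrow> \<phi> \<circ> X \<in> dual s"
  unfolding dual_def End_def by (auto intro: Vector_Spaces.linear_compose)

lemma tensor_map_simple_tensor:
  assumes "X \<in> End sA" "Y \<in> End sB" "Z \<in> End sC"
  shows "tensor_map sA sB sC X Y Z (simple_tensor sA sB sC a b c) =
         simple_tensor sA sB sC (X a) (Y b) (Z c)"
  using assms by (auto simp: tensor_map_def simple_tensor_def on_duals_def dual_comp_End fun_eq_iff)

lemma tensor_map_add:
  "tensor_map sA sB sC X Y Z (S + T) =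
   tensor_map sA sB sC X Y Z S + tensor_map sA sB sC X Y Z T"
  by (auto simp: tensor_map_def on_duals_def fun_eq_iff)

lemma tensor_map_scale:
  "tensor_map sA sB sC X Y Z (tensor_scale z T) = tensor_scale z (tensor_map sA sB sC X Y Z T)"
  by (auto simp: tensor_map_def on_duals_def tensor_scale_def fun_eq_iff)

definition act_A ::
    "(complex \<Rightarrow> 'a \<Rightarrow> 'a::ab_group_add) \<Rightarrow> (complex \<Rightarrow> 'b \<Rightarrow> 'b::ab_group_add) \<Rightarrow>
     (complex \<Rightarrow> 'c \<Rightarrow> 'c::ab_group_add) \<Rightarrow> ('a \<Rightarrow> 'a) \<Rightarrow> ('a, 'b, 'c) tensor \<Rightarrow> ('a, 'b, 'c) tensor" where
  "act_A sA sB sC X T = tensor_map sA sB sC X id id T"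

definition act_B ::
    "(complex \<Rightarrow> 'a \<Rightarrow> 'a::ab_group_add) \<Rightarrow> (complex \<Rightarrow> 'b \<Rightarrow> 'b::ab_group_add) \<Rightarrow>
     (complex \<Rightarrow> 'c \<Rightarrow> 'c::ab_group_add) \<Rightarrow> ('b \<Rightarrow> 'b) \<Rightarrow> ('a, 'b, 'c) tensor \<Rightarrow> ('a, 'b, 'c) tensor" where
  "act_B sA sB sC Y T = tensor_map sA sB sC id Y id T"

definition act_C ::
    "(complex \<Rightarrow> 'a \<Rightarrow> 'a::ab_group_add) \<Rightarrow> (complex \<Rightarrow> 'b \<Rightarrow> 'b::ab_group_add) \<Rightarrow>
     (complex \<Rightarrow> 'c \<Rightarrow> 'c::ab_group_add) \<Rightarrow> ('c \<Rightarrow> 'c) \<Rightarrow> ('a, 'b, 'c) tensor \<Rightarrow> ('a, 'b, 'c) tensor" where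
  "act_C sA sB sC Z T = tensor_map sA sB sC id id Z T"

text \<open>
  The three conditions are injectivity of the contractions \<open>A\<^sup>* \<rightarrow> B \<otimes> C\<close>, \<open>B\<^sup>* \<rightarrow> A \<otimes> C\<close> and
  \<open>C\<^sup>* \<rightarrow> A \<otimes> B\<close>, with bilinear forms on the duals for the two-fold tensor products.
\<close>

definition concise ::
    "(complex \<Rightarrow> 'a \<Rightarrow> 'a::ab_group_add) \<Rightarrow> (complex \<Rightarrow> 'b \<Rightarrow> 'b::ab_group_add) \<Rightarrow>
     (complex \<Rightarrow> 'c \<Rightarrow> 'c::ab_group_add) \<Rightarrow> ('a, 'b, 'c) tensor \<Rightarrow> bool" where
  "concise sA sB sC T \<longleftrightarrow>
     inj_on (\<lambda>\<alpha>. \<lambda>\<beta> \<gamma>. T \<alpha> \<beta> \<gamma>) (dual sA) \<and>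
     inj_on (\<lambda>\<beta>. \<lambda>\<alpha> \<gamma>. T \<alpha> \<beta> \<gamma>) (dual sB) \<and>
     inj_on (\<lambda>\<gamma>. \<lambda>\<alpha> \<beta>. T \<alpha> \<beta> \<gamma>) (dual sC)"

definition compatible ::
    "(complex \<Rightarrow> 'a \<Rightarrow> 'a::ab_group_add) \<Rightarrow> (complex \<Rightarrow> 'b \<Rightarrow> 'b::ab_group_add) \<Rightarrow>
     (complex \<Rightarrow> 'c \<Rightarrow> 'c::ab_group_add) \<Rightarrow> ('a, 'b, 'c) tensor \<Rightarrow>
     ('a \<Rightarrow> 'a) \<times> ('b \<Rightarrow> 'b) \<times> ('c \<Rightarrow> 'c) \<Rightarrow> bool" where
  "compatible sA sB sC T = (\<lambda>(X, Y, Z).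
     act_A sA sB sC X T = act_B sA sB sC Y T \<and> act_B sA sB sC Y T = act_C sA sB sC Z T)"

definition algebra111 ::
    "(complex \<Rightarrow> 'a \<Rightarrow> 'a::ab_group_add) \<Rightarrow> (complex \<Rightarrow> 'b \<Rightarrow> 'b::ab_group_add) \<Rightarrow>
     (complex \<Rightarrow> 'c \<Rightarrow> 'c::ab_group_add) \<Rightarrow> ('a, 'b, 'c) tensor \<Rightarrow>
     (('a \<Rightarrow> 'a) \<times> ('b \<Rightarrow> 'b) \<times> ('c \<Rightarrow> 'c)) set" where
  "algebra111 sA sB sC T = {p \<in> End sA \<times> End sB \<times> End sC. compatible sA sB sC T p}"

text \<open>
  The algebra structure on \<open>End(A) \<times> End(B) \<times> End(C)\<close>: addition is the componentwise and
  pointwise \<open>+\<close> of the function and product instances, the product is componentwise composition.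
\<close>

definition triple_scale ::
    "(complex \<Rightarrow> 'a \<Rightarrow> 'a) \<Rightarrow> (complex \<Rightarrow> 'b \<Rightarrow> 'b) \<Rightarrow> (complex \<Rightarrow> 'c \<Rightarrow> 'c) \<Rightarrow> complex \<Rightarrow>
     ('a \<Rightarrow> 'a) \<times> ('b \<Rightarrow> 'b) \<times> ('c \<Rightarrow> 'c) \<Rightarrow> ('a \<Rightarrow> 'a) \<times> ('b \<Rightarrow> 'b) \<times> ('c \<Rightarrow> 'c)" where
  "triple_scale sA sB sC z = (\<lambda>(X, Y, Z). (\<lambda>a. sA z (X a), \<lambda>b. sB z (Y b), \<lambda>c. sC z (Z c)))"

definition triple_comp ::
    "('a \<Rightarrow> 'a) \<times> ('b \<Rightarrow> 'b) \<times> ('c \<Rightarrow> 'c) \<Rightarrow> ('a \<Rightarrow> 'a) \<times> ('b \<Rightarrow> 'b) \<times> ('c \<Rightarrow> 'c) \<Rightarrow>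
     ('a \<Rightarrow> 'a) \<times> ('b \<Rightarrow> 'b) \<times> ('c \<Rightarrow> 'c)" where
  "triple_comp = (\<lambda>(X, Y, Z) (X', Y', Z'). (X \<circ> X', Y \<circ> Y', Z \<circ> Z'))"

definition unital_subalgebra ::
    "(complex \<Rightarrow> 'a \<Rightarrow> 'a::ab_group_add) \<Rightarrow> (complex \<Rightarrow> 'b \<Rightarrow> 'b::ab_group_add) \<Rightarrow>
     (complex \<Rightarrow> 'c \<Rightarrow> 'c::ab_group_add) \<Rightarrow>
     (('a \<Rightarrow> 'a) \<times> ('b \<Rightarrow> 'b) \<times> ('c \<Rightarrow> 'c)) set \<Rightarrow> bool" where
  "unital_subalgebra sA sB sC S \<longleftrightarrow>
     S \<subseteq> End sA \<times> End sB \<times> End sC \<and>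
     module.subspace (triple_scale sA sB sC) S \<and>
     (id, id, id) \<in> S \<and>
     (\<forall>p\<in>S. \<forall>q\<in>S. triple_comp p q \<in> S)"

definition commutative_triples :: "(('a \<Rightarrow> 'a) \<times> ('b \<Rightarrow> 'b) \<times> ('c \<Rightarrow> 'c)) set \<Rightarrow> bool" where
  "commutative_triples S \<longleftrightarrow> (\<forall>p\<in>S. \<forall>q\<in>S. triple_comp p q = triple_comp q p)"

lemma module_triple_scale:
  assumes "vector_space sA" "vector_space sB" "vector_space sC"
  shows "module (triple_scale sA sB sC)"
proof -
  interpret A: vector_space sA by fact
  interpret B: vector_space sB by fact
  interpret C: vector_space sC by fact
  show ?thesis
    by unfold_locales
      (auto simp: triple_scale_def fun_eq_iff algebra_simps A.scale_right_distrib
        A.scale_left_distrib B.scale_right_distrib B.scale_left_distrib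
        C.scale_right_distrib C.scale_left_distrib)
qed

end

theory Submission imports Defs begin

text \<open>
  The tensor \<open>T\<close> is a trilinear form in functionals \<open>\<alpha>\<close>, \<open>\<beta>\<close>, \<open>\<gamma>\<close>. A triple
  \<open>(X, Y, Z)\<close> of endomorphisms is compatible with \<open>T\<close> exactly when a factor can be moved freely between the three arguments:
  \<open>T (\<alpha> X, \<beta>, \<gamma>) = T (\<alpha>, \<beta> Y, \<gamma>) = T (\<alpha>, \<beta>, \<gamma> Z)\<close> (lemma \<open>algebra111_iff\<close>). Everything follows by
  moving factors around and then using conciseness, which lets one cancel \<open>T\<close> and compare
  functionals (lemma \<open>concise_cancel\<close>); since functionals separate points, comparing all
  \<open>\<alpha> X\<close> with \<open>\<alpha> X'\<close> compares \<open>X\<close> with \<open>X'\<close>.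

  \<^item> Commutativity: given a second compatible triple \<open>(X', Y', Z')\<close>, move \<open>X'\<close> to the second
    argument, \<open>X\<close> to the third, and then bring both back in the opposite order:
    \<open>T (\<alpha> X X', \<beta>, \<gamma>) = T (\<alpha> X, \<beta> Y', \<gamma>) = T (\<alpha>, \<beta> Y', \<gamma> Z) = T (\<alpha> X', \<beta>, \<gamma> Z) = T (\<alpha> X' X, \<beta>, \<gamma>)\<close>.
    This is where having three factors, and not two, is decisive (lemma \<open>commute_A\<close>).
  \<^item> Closure under composition: moving \<open>X X'\<close> to the second argument gives
    \<open>T (\<alpha> X X', \<beta>, \<gamma>) = T (\<alpha>, \<beta> Y' Y, \<gamma>)\<close>, with the order reversed. So compatibility of the product
    is a consequence of commutativity (lemma \<open>comp_mem\<close>).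
  \<^item> Closure under linear combinations is trilinearity of \<open>T\<close>.
  \<^item> Injectivity of the projections: \<open>X\<close> determines \<open>T (\<alpha>, \<beta> Y, \<gamma>) = T (\<alpha> X, \<beta>, \<gamma>)\<close>, hence \<open>Y\<close>,
    and likewise \<open>Z\<close>.

  The three factors play the same role. Linearity of \<open>T\<close>, commutativity and injectivity are
  established for \<open>A\<close> and transported to \<open>B\<close> and \<open>C\<close> by rotating \<open>A \<otimes> B \<otimes> C\<close> to \<open>B \<otimes> C \<otimes> A\<close>.
\<close>

section \<open>Linear functionals\<close>

lemma dual_combination:
  assumes "\<alpha> \<in> dual s" "\<alpha>' \<in> dual s"
  shows "(\<lambda>a. z * \<alpha> a + w * \<alpha>' a) \<in> dual s"
proof -
  interpret f: Vector_Spaces.linear s "(*)" \<alpha> using assms(1) by (simp add: dual_def)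
  interpret g: Vector_Spaces.linear s "(*)" \<alpha>' using assms(2) by (simp add: dual_def)
  show ?thesis
    unfolding dual_def
    by (simp, unfold_locales) (simp_all add: f.add g.add f.scale g.scale distrib_left mult.left_commute)
qed

text \<open>A nonzero \<open>x\<close> is part of a basis, so some functional takes the value 1 on it.\<close>

lemma dual_separates_zero:
  assumes "vector_space s" and "\<And>\<alpha>. \<alpha> \<in> dual s \<Longrightarrow> \<alpha> x = 0"
  shows "x = 0"
proof (rule ccontr)
  assume "x \<noteq> 0"
  interpret V: vector_space s by fact
  interpret vector_space_pair s "(*) :: complex \<Rightarrow> complex \<Rightarrow> complex"
    by unfold_locales (simp_all add: algebra_simps)
  have "V.independent {x}" using \<open>x \<noteq> 0\<close> by simp
  from linear_independent_extend[OF this, of "\<lambda>_. 1"]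
  obtain g where "Vector_Spaces.linear s (*) g" "g x = 1" by auto
  then show False using assms(2)[of g] by (simp add: dual_def)
qed

lemma maps_eq_if_pullbacks_eq:
  assumes "vector_space s" and "\<And>\<alpha>. \<alpha> \<in> dual s \<Longrightarrow> \<alpha> \<circ> X = \<alpha> \<circ> X'"
  shows "X = X'"
proof
  fix x
  have "\<alpha> (X x - X' x) = 0" if "\<alpha> \<in> dual s" for \<alpha>
  proof -
    interpret f: Vector_Spaces.linear s "(*)" \<alpha> using that by (simp add: dual_def)
    show ?thesis using assms(2)[OF that] by (simp add: f.diff fun_eq_iff)
  qed
  then have "X x - X' x = 0" by (rule dual_separates_zero[OF assms(1)])
  then show "X x = X' x" by simp
qed

lemma End_id: "vector_space s \<Longrightarrow> id \<in> End s"
  by (simp add: End_def vector_space.linear_id)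

lemma End_comp: "X \<in> End s \<Longrightarrow> X' \<in> End s \<Longrightarrow> X \<circ> X' \<in> End s"
  unfolding End_def by (auto intro: Vector_Spaces.linear_compose)

lemma End_combination:
  assumes "X \<in> End s" "X' \<in> End s"
  shows "(\<lambda>a. s z (X a) + s w (X' a)) \<in> End s"
proof -
  interpret f: Vector_Spaces.linear s s X using assms(1) by (simp add: End_def)
  interpret g: Vector_Spaces.linear s s X' using assms(2) by (simp add: End_def)
  show ?thesis
    unfolding End_def
    by (simp, unfold_locales)
      (simp_all add: f.add g.add f.scale g.scale f.vs1.scale_right_distrib mult.commute)
qed

lemma dual_comp_combination:
  assumes "\<alpha> \<in> dual s"
  shows "\<alpha> \<circ> (\<lambda>a. s z (X a) + s w (X' a)) = (\<lambda>a. z * (\<alpha> \<circ> X) a + w * (\<alpha> \<circ> X') a)"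
proof -
  interpret f: Vector_Spaces.linear s "(*)" \<alpha> using assms by (simp add: dual_def)
  show ?thesis by (simp add: fun_eq_iff f.add f.scale)
qed

section \<open>Tensors as trilinear forms\<close>

text \<open>The span is reached from 0 by adding multiples of \<open>a \<otimes> b \<otimes> c\<close> one at a time; the sums are
  written out pointwise, the form in which tensors are evaluated on functionals.\<close>

lemma tensor_product_induct [consumes 1, case_names zero step]:
  assumes "T \<in> tensor_product sA sB sC"
    and "P (\<lambda>_ _ _. 0)"
    and "\<And>z a b c S. P S \<Longrightarrow>
           P (\<lambda>\<alpha> \<beta> \<gamma>. z * simple_tensor sA sB sC a b c \<alpha> \<beta> \<gamma> + S \<alpha> \<beta> \<gamma>)"
  shows "P T"
proof -
  interpret M: module "tensor_scale :: complex \<Rightarrow> ('a, 'b, 'c) tensor \<Rightarrow> _"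
    by (rule module_tensor_scale)
  from assms(1)[unfolded tensor_product_def] show ?thesis
  proof (induction rule: M.span_induct_alt)
    case base
    then show ?case using assms(2) by (simp add: zero_fun_def)
  next
    case (step z S U)
    then obtain a b c where "S = simple_tensor sA sB sC a b c" by blast
    then show ?case
      using assms(3)[of U z a b c] step by (simp add: plus_fun_def tensor_scale_def)
  qed
qed


lemma tensor_zero_off_duals:
  assumes "T \<in> tensor_product sA sB sC" "\<not> (\<alpha> \<in> dual sA \<and> \<beta> \<in> dual sB \<and> \<gamma> \<in> dual sC)"
  shows "T \<alpha> \<beta> \<gamma> = 0"
  using assms(1)
proof (induction rule: tensor_product_induct)
  case (step z a b c S)
  then show ?case using assms(2) by (auto simp: simple_tensor_def on_duals_def)
qed simp

lemma tensor_linear_A: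
  assumes "T \<in> tensor_product sA sB sC" "\<alpha> \<in> dual sA" "\<alpha>' \<in> dual sA"
  shows "T (\<lambda>a. z * \<alpha> a + w * \<alpha>' a) \<beta> \<gamma> = z * T \<alpha> \<beta> \<gamma> + w * T \<alpha>' \<beta> \<gamma>"
  using assms(1)
proof (induction rule: tensor_product_induct)
  case (step y a b c S)
  have "simple_tensor sA sB sC a b c (\<lambda>a. z * \<alpha> a + w * \<alpha>' a) \<beta> \<gamma> =
      z * simple_tensor sA sB sC a b c \<alpha> \<beta> \<gamma> + w * simple_tensor sA sB sC a b c \<alpha>' \<beta> \<gamma>"
    using assms(2,3) dual_combination[OF assms(2,3), of z w]
    by (simp add: simple_tensor_def on_duals_def distrib_right mult.assoc)
  then show ?case
    unfolding step by (simp only: distrib_left mult.left_commute add.assoc add.left_commute)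
qed simp

text \<open>The isomorphism of \<open>A \<otimes> B \<otimes> C\<close> with \<open>B \<otimes> C \<otimes> A\<close> sending \<open>a \<otimes> b \<otimes> c\<close> to \<open>b \<otimes> c \<otimes> a\<close>.\<close>

definition rotate :: "('a, 'b, 'c) tensor \<Rightarrow> ('b, 'c, 'a) tensor" where
  "rotate T = (\<lambda>\<beta> \<gamma> \<alpha>. T \<alpha> \<beta> \<gamma>)"

lemma rotate_mem:
  assumes "T \<in> tensor_product sA sB sC"
  shows "rotate T \<in> tensor_product sB sC sA"
  using assms
proof (induction rule: tensor_product_induct)
  interpret M: module "tensor_scale :: complex \<Rightarrow> ('b, 'c, 'a) tensor \<Rightarrow> _"
    by (rule module_tensor_scale)
  {
    case zero
    have "rotate (\<lambda>_ _ _. 0) = (0 :: ('b, 'c, 'a) tensor)"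
      by (intro ext) (simp add: rotate_def)
    then show ?case
      unfolding tensor_product_def by (simp only: M.span_zero)
  next
    case (step z a b c S)
    have "simple_tensor sB sC sA b c a \<in> tensor_product sB sC sA"
      unfolding tensor_product_def by (rule M.span_base) blast
    then have "tensor_scale z (simple_tensor sB sC sA b c a) + rotate S \<in> tensor_product sB sC sA"
      using step(1) unfolding tensor_product_def by (intro M.span_add M.span_scale)
    also have "tensor_scale z (simple_tensor sB sC sA b c a) + rotate S =
        rotate (\<lambda>\<alpha> \<beta> \<gamma>. z * simple_tensor sA sB sC a b c \<alpha> \<beta> \<gamma> + S \<alpha> \<beta> \<gamma>)"
      by (intro ext) (simp add: rotate_def tensor_scale_def simple_tensor_def on_duals_def)
    finally show ?case .
  }
qed

lemma inj_on_flip: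
  assumes "inj_on F D"
  shows "inj_on (\<lambda>x y z. F x z y) D"
proof (rule inj_onI)
  fix x x' assume x: "x \<in> D" "x' \<in> D" and eq: "(\<lambda>y z. F x z y) = (\<lambda>y z. F x' z y)"
  have "F x z y = F x' z y" for y z
    using eq by (simp add: fun_eq_iff)
  then have "F x = F x'" by (intro ext)
  then show "x = x'" using assms x by (blast dest: inj_onD)
qed

lemma rotate_concise:
  assumes "concise sA sB sC T"
  shows "concise sB sC sA (rotate T)"
  using assms inj_on_flip[of "\<lambda>\<beta> \<alpha> \<gamma>. T \<alpha> \<beta> \<gamma>" "dual sB"]
    inj_on_flip[of "\<lambda>\<gamma> \<alpha> \<beta>. T \<alpha> \<beta> \<gamma>" "dual sC"]
  unfolding concise_def rotate_def by simp

lemma tensor_linear_B: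
  assumes "T \<in> tensor_product sA sB sC" "\<beta> \<in> dual sB" "\<beta>' \<in> dual sB"
  shows "T \<alpha> (\<lambda>b. z * \<beta> b + w * \<beta>' b) \<gamma> = z * T \<alpha> \<beta> \<gamma> + w * T \<alpha> \<beta>' \<gamma>"
  using tensor_linear_A[OF rotate_mem[OF assms(1)] assms(2,3)] by (simp add: rotate_def)

lemma tensor_linear_C:
  assumes "T \<in> tensor_product sA sB sC" "\<gamma> \<in> dual sC" "\<gamma>' \<in> dual sC"
  shows "T \<alpha> \<beta> (\<lambda>c. z * \<gamma> c + w * \<gamma>' c) = z * T \<alpha> \<beta> \<gamma> + w * T \<alpha> \<beta> \<gamma>'"
  using tensor_linear_B[OF rotate_mem[OF assms(1)] assms(2,3)] by (simp add: rotate_def)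

text \<open>Conciseness compares two functionals by all values of the form \<open>T\<close>. Only values on the duals
  have to be compared, because a tensor vanishes on all other arguments.\<close>

lemma concise_cancel:
  assumes "T \<in> tensor_product sA sB sC" "concise sA sB sC T"
    and "\<alpha> \<in> dual sA" "\<alpha>' \<in> dual sA"
    and "\<And>\<beta> \<gamma>. \<beta> \<in> dual sB \<Longrightarrow> \<gamma> \<in> dual sC \<Longrightarrow> T \<alpha> \<beta> \<gamma> = T \<alpha>' \<beta> \<gamma>"
  shows "\<alpha> = \<alpha>'"
proof -
  have "T \<alpha> \<beta> \<gamma> = T \<alpha>' \<beta> \<gamma>" for \<beta> \<gamma>
    using assms(5) tensor_zero_off_duals[OF assms(1)] by metis
  then show ?thesis
    using assms(2-4) unfolding concise_def inj_on_def by blast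
qed

lemma endomorphism_cancel:
  assumes "vector_space sA" "T \<in> tensor_product sA sB sC" "concise sA sB sC T"
    and "X \<in> End sA" "X' \<in> End sA"
    and "\<And>\<alpha> \<beta> \<gamma>. \<alpha> \<in> dual sA \<Longrightarrow> \<beta> \<in> dual sB \<Longrightarrow> \<gamma> \<in> dual sC \<Longrightarrow>
           T (\<alpha> \<circ> X) \<beta> \<gamma> = T (\<alpha> \<circ> X') \<beta> \<gamma>"
  shows "X = X'"
proof (rule maps_eq_if_pullbacks_eq[OF assms(1)])
  fix \<alpha> assume "\<alpha> \<in> dual sA"
  then show "\<alpha> \<circ> X = \<alpha> \<circ> X'"
    using assms by (intro concise_cancel[OF assms(2,3)] dual_comp_End)
qed

section \<open>The 111-algebra\<close>

lemma algebra111_iff: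
  "(X, Y, Z) \<in> algebra111 sA sB sC T \<longleftrightarrow>
     X \<in> End sA \<and> Y \<in> End sB \<and> Z \<in> End sC \<and>
     (\<forall>\<alpha>\<in>dual sA. \<forall>\<beta>\<in>dual sB. \<forall>\<gamma>\<in>dual sC.
        T (\<alpha> \<circ> X) \<beta> \<gamma> = T \<alpha> (\<beta> \<circ> Y) \<gamma> \<and> T \<alpha> (\<beta> \<circ> Y) \<gamma> = T \<alpha> \<beta> (\<gamma> \<circ> Z))"
proof -
  have on_duals_eq_iff: "on_duals sA sB sC F = on_duals sA sB sC G \<longleftrightarrow>
      (\<forall>\<alpha>\<in>dual sA. \<forall>\<beta>\<in>dual sB. \<forall>\<gamma>\<in>dual sC. F \<alpha> \<beta> \<gamma> = G \<alpha> \<beta> \<gamma>)" for F G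
    unfolding on_duals_def fun_eq_iff by auto
  show ?thesis
    unfolding algebra111_def compatible_def act_A_def act_B_def act_C_def tensor_map_def
    by (auto simp: on_duals_eq_iff)
qed

lemma algebra111D:
  assumes "(X, Y, Z) \<in> algebra111 sA sB sC T"
  shows "X \<in> End sA" "Y \<in> End sB" "Z \<in> End sC"
    and "\<And>\<alpha> \<beta> \<gamma>. \<alpha> \<in> dual sA \<Longrightarrow> \<beta> \<in> dual sB \<Longrightarrow> \<gamma> \<in> dual sC \<Longrightarrow> T (\<alpha> \<circ> X) \<beta> \<gamma> = T \<alpha> (\<beta> \<circ> Y) \<gamma>"
    and "\<And>\<alpha> \<beta> \<gamma>. \<alpha> \<in> dual sA \<Longrightarrow> \<beta> \<in> dual sB \<Longrightarrow> \<gamma> \<in> dual sC \<Longrightarrow> T \<alpha> (\<beta> \<circ> Y) \<gamma> = T \<alpha> \<beta> (\<gamma> \<circ> Z)"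
  using assms unfolding algebra111_iff by blast+

lemma rotate_algebra111:
  assumes "(X, Y, Z) \<in> algebra111 sA sB sC T"
  shows "(Y, Z, X) \<in> algebra111 sB sC sA (rotate T)"
  using assms unfolding algebra111_iff rotate_def by metis

text \<open>In \<open>T (\<alpha> X X', \<beta>, \<gamma>)\<close> only \<open>X'\<close> stands next to the argument slot, so it has to leave before
  \<open>X\<close> can. Once \<open>X'\<close> and \<open>X\<close> sit in two different arguments, they can come back in either order.\<close>

lemma commute_A:
  assumes "vector_space sA" "T \<in> tensor_product sA sB sC" "concise sA sB sC T"
    and p: "(X, Y, Z) \<in> algebra111 sA sB sC T" and q: "(X', Y', Z') \<in> algebra111 sA sB sC T"
  shows "X \<circ> X' = X' \<circ> X"
proof (rule endomorphism_cancel[OF assms(1-3)])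
  note P = algebra111D[OF p] and Q = algebra111D[OF q]
  fix \<alpha> \<beta> \<gamma> assume duals: "\<alpha> \<in> dual sA" "\<beta> \<in> dual sB" "\<gamma> \<in> dual sC"
  have "T (\<alpha> \<circ> X \<circ> X') \<beta> \<gamma> = T (\<alpha> \<circ> X) (\<beta> \<circ> Y') \<gamma>"
    using duals P(1) Q(4) by (simp add: dual_comp_End)
  also have "\<dots> = T \<alpha> (\<beta> \<circ> Y') (\<gamma> \<circ> Z)"
    using duals P(4,5) Q(2) by (simp add: dual_comp_End)
  also have "\<dots> = T (\<alpha> \<circ> X') \<beta> (\<gamma> \<circ> Z)"
    using duals P(3) Q(4) by (simp add: dual_comp_End)
  also have "\<dots> = T (\<alpha> \<circ> X' \<circ> X) \<beta> \<gamma>"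
    using duals P(4,5) Q(1) by (simp add: dual_comp_End)
  finally show "T (\<alpha> \<circ> (X \<circ> X')) \<beta> \<gamma> = T (\<alpha> \<circ> (X' \<circ> X)) \<beta> \<gamma>"
    by (simp add: o_assoc)
qed (use algebra111D(1)[OF p] algebra111D(1)[OF q] in \<open>simp_all add: End_comp\<close>)

lemma commute_B:
  assumes "vector_space sB" "T \<in> tensor_product sA sB sC" "concise sA sB sC T"
    and "(X, Y, Z) \<in> algebra111 sA sB sC T" "(X', Y', Z') \<in> algebra111 sA sB sC T"
  shows "Y \<circ> Y' = Y' \<circ> Y"
  using commute_A[OF assms(1) rotate_mem rotate_concise rotate_algebra111 rotate_algebra111] assms
  by blast

lemma commute_C:
  assumes "vector_space sC" "T \<in> tensor_product sA sB sC" "concise sA sB sC T"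
    and "(X, Y, Z) \<in> algebra111 sA sB sC T" "(X', Y', Z') \<in> algebra111 sA sB sC T"
  shows "Z \<circ> Z' = Z' \<circ> Z"
  using commute_B[OF assms(1) rotate_mem rotate_concise rotate_algebra111 rotate_algebra111] assms
  by blast

text \<open>Moving a product to another argument reverses its order, so the product of two compatible
  triples would in general pair \<open>X \<circ> X'\<close> with \<open>Y' \<circ> Y\<close>. Commutativity in the second factor repairs
  this; between the second and the third it is used once more.\<close>

lemma comp_mem:
  assumes "vector_space sB" "vector_space sC"
    and T: "T \<in> tensor_product sA sB sC" "concise sA sB sC T"
    and p: "(X, Y, Z) \<in> algebra111 sA sB sC T" and q: "(X', Y', Z') \<in> algebra111 sA sB sC T"
  shows "(X \<circ> X', Y \<circ> Y', Z \<circ> Z') \<in> algebra111 sA sB sC T"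
proof -
  note P = algebra111D[OF p] and Q = algebra111D[OF q]
  have "T (\<alpha> \<circ> (X \<circ> X')) \<beta> \<gamma> = T \<alpha> (\<beta> \<circ> (Y \<circ> Y')) \<gamma> \<and>
        T \<alpha> (\<beta> \<circ> (Y \<circ> Y')) \<gamma> = T \<alpha> \<beta> (\<gamma> \<circ> (Z \<circ> Z'))"
    if duals: "\<alpha> \<in> dual sA" "\<beta> \<in> dual sB" "\<gamma> \<in> dual sC" for \<alpha> \<beta> \<gamma>
  proof
    have "T (\<alpha> \<circ> X \<circ> X') \<beta> \<gamma> = T (\<alpha> \<circ> X) (\<beta> \<circ> Y') \<gamma>"
      using duals P(1) Q(4) by (simp add: dual_comp_End)
    also have "\<dots> = T \<alpha> (\<beta> \<circ> Y' \<circ> Y) \<gamma>"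
      using duals P(4) Q(2) by (simp add: dual_comp_End)
    finally show "T (\<alpha> \<circ> (X \<circ> X')) \<beta> \<gamma> = T \<alpha> (\<beta> \<circ> (Y \<circ> Y')) \<gamma>"
      by (simp add: o_assoc[symmetric] commute_B[OF assms(1) T p q])
    have "T \<alpha> (\<beta> \<circ> Y \<circ> Y') \<gamma> = T \<alpha> (\<beta> \<circ> Y) (\<gamma> \<circ> Z')"
      using duals P(2) Q(5) by (simp add: dual_comp_End)
    also have "\<dots> = T \<alpha> \<beta> (\<gamma> \<circ> Z' \<circ> Z)"
      using duals P(5) Q(3) by (simp add: dual_comp_End)
    finally show "T \<alpha> (\<beta> \<circ> (Y \<circ> Y')) \<gamma> = T \<alpha> \<beta> (\<gamma> \<circ> (Z \<circ> Z'))"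
      by (simp add: o_assoc[symmetric] commute_C[OF assms(2) T p q])
  qed
  then show ?thesis
    unfolding algebra111_iff using P(1-3) Q(1-3) by (simp add: End_comp)
qed

lemma combination_mem:
  assumes T: "T \<in> tensor_product sA sB sC"
    and p: "(X, Y, Z) \<in> algebra111 sA sB sC T" and q: "(X', Y', Z') \<in> algebra111 sA sB sC T"
  shows "(\<lambda>a. sA z (X a) + sA w (X' a), \<lambda>b. sB z (Y b) + sB w (Y' b),
          \<lambda>c. sC z (Z c) + sC w (Z' c)) \<in> algebra111 sA sB sC T"
proof -
  note P = algebra111D[OF p] and Q = algebra111D[OF q]
  have "T (\<alpha> \<circ> (\<lambda>a. sA z (X a) + sA w (X' a))) \<beta> \<gamma> = z * T (\<alpha> \<circ> X) \<beta> \<gamma> + w * T (\<alpha> \<circ> X') \<beta> \<gamma>"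
    and "T \<alpha> (\<beta> \<circ> (\<lambda>b. sB z (Y b) + sB w (Y' b))) \<gamma> = z * T \<alpha> (\<beta> \<circ> Y) \<gamma> + w * T \<alpha> (\<beta> \<circ> Y') \<gamma>"
    and "T \<alpha> \<beta> (\<gamma> \<circ> (\<lambda>c. sC z (Z c) + sC w (Z' c))) = z * T \<alpha> \<beta> (\<gamma> \<circ> Z) + w * T \<alpha> \<beta> (\<gamma> \<circ> Z')"
    if "\<alpha> \<in> dual sA" "\<beta> \<in> dual sB" "\<gamma> \<in> dual sC" for \<alpha> \<beta> \<gamma>
    unfolding that[THEN dual_comp_combination]
    using that P(1-3) Q(1-3)
    by (blast intro: tensor_linear_A[OF T] tensor_linear_B[OF T] tensor_linear_C[OF T]
        dual_comp_End)+
  then show ?thesis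
    unfolding algebra111_iff using P Q by (simp add: End_combination)
qed

text \<open>All three closure conditions are instances of closure under \<open>z p + w q\<close>; the identity triple
  serves as a summand with coefficient 0 where no second element is given.\<close>

lemma subspace_algebra111:
  assumes vs: "vector_space sA" "vector_space sB" "vector_space sC"
    and T: "T \<in> tensor_product sA sB sC"
    and one: "(id, id, id) \<in> algebra111 sA sB sC T"
  shows "module.subspace (triple_scale sA sB sC) (algebra111 sA sB sC T)"
proof -
  interpret A: vector_space sA by fact
  interpret B: vector_space sB by fact
  interpret C: vector_space sC by fact
  interpret M: module "triple_scale sA sB sC" using vs by (rule module_triple_scale)
  show ?thesis
  proof (rule M.subspaceI)
    show "0 \<in> algebra111 sA sB sC T"
      using combination_mem[OF T one one, of 0 0] by (simp add: zero_prod_def zero_fun_def)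
  next
    fix p q assume "p \<in> algebra111 sA sB sC T" "q \<in> algebra111 sA sB sC T"
    then show "p + q \<in> algebra111 sA sB sC T"
      using combination_mem[OF T, of _ _ _ _ _ _ 1 1]
      by (cases p, cases q) (simp add: plus_fun_def)
  next
    fix z p assume "p \<in> algebra111 sA sB sC T"
    then show "triple_scale sA sB sC z p \<in> algebra111 sA sB sC T"
      using combination_mem[OF T _ one, of _ _ _ z 0]
      by (cases p) (simp add: triple_scale_def)
  qed
qed

lemma proj_A_inj:
  assumes vs: "vector_space sB" "vector_space sC"
    and T: "T \<in> tensor_product sA sB sC" "concise sA sB sC T"
    and p: "(X, Y, Z) \<in> algebra111 sA sB sC T" and q: "(X, Y', Z') \<in> algebra111 sA sB sC T"
  shows "Y = Y' \<and> Z = Z'"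
proof
  note P = algebra111D[OF p] and Q = algebra111D[OF q]
  note T1 = rotate_mem[OF T(1)] rotate_concise[OF T(2)]
  note T2 = rotate_mem[OF T1(1)] rotate_concise[OF T1(2)]
  show "Y = Y'"
  proof (rule endomorphism_cancel[OF vs(1) T1 P(2) Q(2)])
    fix \<beta> \<gamma> \<alpha> assume "\<beta> \<in> dual sB" "\<gamma> \<in> dual sC" "\<alpha> \<in> dual sA"
    then show "rotate T (\<beta> \<circ> Y) \<gamma> \<alpha> = rotate T (\<beta> \<circ> Y') \<gamma> \<alpha>"
      using P(4)[of \<alpha> \<beta> \<gamma>] Q(4)[of \<alpha> \<beta> \<gamma>] by (simp add: rotate_def)
  qed
  show "Z = Z'"
  proof (rule endomorphism_cancel[OF vs(2) T2 P(3) Q(3)])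
    fix \<gamma> \<alpha> \<beta> assume "\<gamma> \<in> dual sC" "\<alpha> \<in> dual sA" "\<beta> \<in> dual sB"
    then show "rotate (rotate T) (\<gamma> \<circ> Z) \<alpha> \<beta> = rotate (rotate T) (\<gamma> \<circ> Z') \<alpha> \<beta>"
      using P(4,5)[of \<alpha> \<beta> \<gamma>] Q(4,5)[of \<alpha> \<beta> \<gamma>] by (simp add: rotate_def)
  qed
qed

theorem theorem1p11:
  fixes sA :: "complex \<Rightarrow> 'a \<Rightarrow> 'a::ab_group_add"
    and sB :: "complex \<Rightarrow> 'b \<Rightarrow> 'b::ab_group_add"
    and sC :: "complex \<Rightarrow> 'c \<Rightarrow> 'c::ab_group_add"
    and m :: nat
    and T :: "('a, 'b, 'c) tensor"
  assumes "vector_space sA" and "vector_space sB" and "vector_space sC"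
    and "has_dimension sA m" and "has_dimension sB m" and "has_dimension sC m"
    and "T \<in> tensor_product sA sB sC"
    and "concise sA sB sC T"
  shows "unital_subalgebra sA sB sC (algebra111 sA sB sC T)
    \<and> commutative_triples (algebra111 sA sB sC T)
    \<and> inj_on (\<lambda>(X, Y, Z). X) (algebra111 sA sB sC T)
    \<and> inj_on (\<lambda>(X, Y, Z). Y) (algebra111 sA sB sC T)
    \<and> inj_on (\<lambda>(X, Y, Z). Z) (algebra111 sA sB sC T)"
proof (intro conjI)
  let ?S = "algebra111 sA sB sC T"
  note vs = assms(1-3) and T = assms(7,8)
  note T1 = rotate_mem[OF T(1)] rotate_concise[OF T(2)]
  note T2 = rotate_mem[OF T1(1)] rotate_concise[OF T1(2)]
  have one: "(id, id, id) \<in> ?S"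
    using vs by (simp add: algebra111_iff End_id)
  have "?S \<subseteq> End sA \<times> End sB \<times> End sC"
    by (auto simp: algebra111_def)
  moreover have "triple_comp p q \<in> ?S" if "p \<in> ?S" "q \<in> ?S" for p q
    using that comp_mem[OF vs(2,3) T]
    by (cases p, cases q) (simp add: triple_comp_def)
  ultimately show "unital_subalgebra sA sB sC ?S"
    unfolding unital_subalgebra_def using one subspace_algebra111[OF vs T(1) one] by blast
  have "triple_comp p q = triple_comp q p" if "p \<in> ?S" "q \<in> ?S" for p q
  proof -
    obtain X Y Z X' Y' Z' where pq: "p = (X, Y, Z)" "q = (X', Y', Z')"
      by (cases p, cases q)
    have "X \<circ> X' = X' \<circ> X" "Y \<circ> Y' = Y' \<circ> Y" "Z \<circ> Z' = Z' \<circ> Z"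
      using that unfolding pq
      by (rule commute_A[OF vs(1) T] commute_B[OF vs(2) T] commute_C[OF vs(3) T])+
    then show ?thesis by (simp add: pq triple_comp_def)
  qed
  then show "commutative_triples ?S"
    by (simp add: commutative_triples_def)
  have rot: "(Y, Z, X) \<in> algebra111 sB sC sA (rotate T)"
            "(Z, X, Y) \<in> algebra111 sC sA sB (rotate (rotate T))"
    if "(X, Y, Z) \<in> ?S" for X Y Z
    using that by (blast intro: rotate_algebra111)+
  have "Y = Y' \<and> Z = Z'" if "(X, Y, Z) \<in> ?S" "(X, Y', Z') \<in> ?S" for X Y Z Y' Z'
    using that by (rule proj_A_inj[OF vs(2,3) T])
  then show "inj_on (\<lambda>(X, Y, Z). X) ?S"
    unfolding inj_on_def by fast
  have "X = X' \<and> Z = Z'" if "(X, Y, Z) \<in> ?S" "(X', Y, Z') \<in> ?S" for X Y Z X' Z'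
    using proj_A_inj[OF vs(3,1) T1 that[THEN rot(1)]] by blast
  then show "inj_on (\<lambda>(X, Y, Z). Y) ?S"
    unfolding inj_on_def by fast
  have "X = X' \<and> Y = Y'" if "(X, Y, Z) \<in> ?S" "(X', Y', Z) \<in> ?S" for X Y Z X' Y'
    using that[THEN rot(2)] by (rule proj_A_inj[OF vs(1,2) T2])
  then show "inj_on (\<lambda>(X, Y, Z). Z) ?S"
    unfolding inj_on_def by fast
qed

end
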